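(* Let $K\ge 1$, let clients $k=1,\dots,K$ have (random) locally optimal selections $S_k^\star\subseteq\mathcal{X}_k$, let $C_1,\dots,C_M$ be the cells, and let $\Phi$, $A_k$, $a_{k,m}$ and the expected redundancy gap $\bar{\Delta}_K^{\mathrm{red}}$ be as defined in the context. Assume that, for each cell $C_m$, the events $\{S_k^\star\cap C_m\neq\emptyset\}$ are (mutually) independent across clients $k$. Then the following hold. 1. If the accessible cell sets are pairwise disjoint, i.e. $A_i\cap A_j=\emptyset$ for all $i\neq j$, then $\bar{\Delta}_K^{\mathrm{red}}=0$. 2. For each $m$, define the contribution of cell $C_m$ to the expected redundancy gap, viewed as a function of $(a_{1,m},\dots,a_{K,m})\in[0,1]^K$, as $$\Delta_m=\sum_{k=1}^K a_{k,m}-\Bigl(1-\prod_{k=1}^K(1-a_{k,m})\Bigr).$$ Then for every $j\in\{1,\dots,K\}$, $$\frac{\partial\Delta_m}{\partial a_{j,m}}=1-\prod_{k\neq j}(1-a_{k,m})\ \geq\ 0,$$ with strict inequality whenever another client selects from $C_m$ with positive probability (i.e. $a_{k,m}>0$ for some $k\ne j$). 3. Let $$c_m^{(K)}=1-\prod_{k=1}^K(1-a_{k,m})$$ be the probability that at least one of the first $K$ clients selects from $C_m$. Then, when a further client $K+1$ is added (the independence assumption holding for all $K+1$ clients), $$\bar{\Delta}_{K+1}^{\mathrm{red}}-\bar{\Delta}_K^{\mathrm{red}}=\sum_{m=1}^M a_{K+1,m}\,c_m^{(K)}.$$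
   Context: Setting. $\mathcal{X}\subseteq\mathbb{R}^d$ is the feature (embedding) space and $\mathcal{Y}$ the label space. Client $k$ has a data distribution $\mathcal{P}_k$ on $\mathcal{X}\times\mathcal{Y}$, and $\mathcal{X}_k=\operatorname{supp}(\mathcal{P}_k^X)\subseteq\mathcal{X}$ is the support of its feature marginal. Client $k$ has an annotation budget $b_k$ (a nonnegative integer). Cells and coverage utility. $\mathcal{X}$ is partitioned into $M$ cells $C_1,\dots,C_M$. For $S\subseteq\mathcal{X}$, the coverage utility is $$\Phi(S)=\sum_{m=1}^M\mathbf{1}\{S\cap C_m\neq\emptyset\}.$$ Local selections. For each client $k$, $S_k^\star$ is a (random) locally optimal selection, $S_k^\star\in\arg\max_{S\subseteq\mathcal{X}_k,\ |S|=b_k}\Phi(S)$; in particular $S_k^\star\subseteq\mathcal{X}_k$. All $S_k^\star$ are defined on a common probability space on which the events $\{S_k^\star\cap C_m\ne\emptyset\}$ are measurable, and $\Pr$, $\mathbb{E}$ refer to this space. Accessible cells and selection probabilities. $A_k=\{m: C_m\cap\mathcal{X}_k\neq\emptyset\}$ and $a_{k,m}=\Pr(S_k^\star\cap C_m\neq\emptyset)$; thus $a_{k,m}=0$ whenever $m\notin A_k$. Expected redundancy gap of clients $1,\dots,K$: $$\bar{\Delta}_K^{\mathrm{red}}=\sum_{k=1}^K\mathbb{E}[\Phi(S_k^\star)]-\mathbb{E}\Bigl[\Phi\Bigl(\bigcup_{k=1}^K S_k^\star\Bigr)\Bigr].$$ $\bar{\Delta}_{K+1}^{\mathrm{red}}$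 is the same quantity for clients $1,\dots,K+1$, with the selections of the first $K$ clients unchanged. *)

theory Defs
  imports "HOL-Probability.Probability"
begin

text \<open>The support is taken relative to the underlying space of the measure: for a measure on
  \<open>restrict_space borel X\<close>, the sets \<open>U \<inter> X\<close> with \<open>U\<close> open are exactly the relatively open sets.\<close>

definition measure_support :: "'a::topological_space measure \<Rightarrow> 'a set" where
  "measure_support \<mu> =
    {x \<in> space \<mu>. \<forall>U. open U \<and> x \<in> U \<longrightarrow> 0 < emeasure \<mu> (U \<inter> space \<mu>)}"

definition feature_marginal ::
    "(real ^ 'd) set \<Rightarrow> ((real ^ 'd) \<times> 'y) measure \<Rightarrow> (real ^ 'd) measure" where
  "feature_marginal X P = distr P (restrict_space borel X) fst"

definition feature_support ::
    "(real ^ 'd) set \<Rightarrow> ((real ^ 'd) \<times> 'y) measure \<Rightarrow> (real ^ 'd) set" where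
  "feature_support X P = measure_support (feature_marginal X P)"

definition coverage :: "nat \<Rightarrow> (nat \<Rightarrow> 'a set) \<Rightarrow> 'a set \<Rightarrow> real" where
  "coverage M C S = (\<Sum>m=1..M. of_bool (S \<inter> C m \<noteq> {}))"

definition accessible_cells ::
    "(real ^ 'd) set \<Rightarrow> nat \<Rightarrow> (nat \<Rightarrow> (real ^ 'd) set) \<Rightarrow> ((real ^ 'd) \<times> 'y) measure \<Rightarrow> nat set"
  where "accessible_cells X M C P = {m \<in> {1..M}. C m \<inter> feature_support X P \<noteq> {}}"

definition hit_event :: "'w measure \<Rightarrow> ('w \<Rightarrow> 'a set) \<Rightarrow> 'a set \<Rightarrow> 'w set" where
  "hit_event \<Omega> S c = {\<omega> \<in> space \<Omega>. S \<omega> \<inter> c \<noteq> {}}"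

definition sel_prob :: "'w measure \<Rightarrow> ('w \<Rightarrow> 'a set) \<Rightarrow> 'a set \<Rightarrow> real" where
  "sel_prob \<Omega> S c = measure \<Omega> (hit_event \<Omega> S c)"

text \<open>A client with data distribution \<open>P\<close>, budget \<open>b\<close> and random selection \<open>S\<close>. Finiteness is
  required separately because the cardinality of an infinite set is \<open>0\<close>.\<close>

definition client ::
    "'w measure \<Rightarrow> (real ^ 'd) set \<Rightarrow> 'y measure \<Rightarrow> nat \<Rightarrow> (nat \<Rightarrow> (real ^ 'd) set)
      \<Rightarrow> ((real ^ 'd) \<times> 'y) measure \<Rightarrow> nat \<Rightarrow> ('w \<Rightarrow> (real ^ 'd) set) \<Rightarrow> bool" where
  "client \<Omega> X Y M C P b S \<longleftrightarrow>
     prob_space P \<and>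
     sets P = sets (restrict_space borel X \<Otimes>\<^sub>M Y) \<and>
     (\<forall>\<omega>\<in>space \<Omega>. is_arg_max (coverage M C)
        (\<lambda>T. T \<subseteq> feature_support X P \<and> finite T \<and> card T = b) (S \<omega>)) \<and>
     (\<forall>m\<in>{1..M}. hit_event \<Omega> S (C m) \<in> sets \<Omega>)"

definition indep_across_clients ::
    "'w measure \<Rightarrow> nat \<Rightarrow> (nat \<Rightarrow> 'a set) \<Rightarrow> nat \<Rightarrow> (nat \<Rightarrow> 'w \<Rightarrow> 'a set) \<Rightarrow> bool" where
  "indep_across_clients \<Omega> M C K S \<longleftrightarrow>
     (\<forall>m\<in>{1..M}. prob_space.indep_events \<Omega> (\<lambda>k. hit_event \<Omega> (S k) (C m)) {1..K})"

definition redundancy_gap ::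
    "'w measure \<Rightarrow> nat \<Rightarrow> (nat \<Rightarrow> 'a set) \<Rightarrow> nat \<Rightarrow> (nat \<Rightarrow> 'w \<Rightarrow> 'a set) \<Rightarrow> real" where
  "redundancy_gap \<Omega> M C K S =
     (\<Sum>k=1..K. (\<integral>\<omega>. coverage M C (S k \<omega>) \<partial>\<Omega>))
       - (\<integral>\<omega>. coverage M C (\<Union>k\<in>{1..K}. S k \<omega>) \<partial>\<Omega>)"

text \<open>The next two are functions of a vector \<open>(a 1, \<dots>, a K)\<close>; only these entries of \<open>a\<close> matter.\<close>

definition cell_contribution :: "nat \<Rightarrow> (nat \<Rightarrow> real) \<Rightarrow> real" where
  "cell_contribution K a = (\<Sum>k=1..K. a k) - (1 - (\<Prod>k=1..K. 1 - a k))"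

definition joint_cover_prob :: "nat \<Rightarrow> (nat \<Rightarrow> real) \<Rightarrow> real" where
  "joint_cover_prob K a = 1 - (\<Prod>k=1..K. 1 - a k)"

end

theory Submission
  imports Defs
begin

text \<open>By linearity of expectation the redundancy gap splits into one term per cell, and
  independence across clients, passed to the complementary events, turns the probability that
  no client hits a cell into a product. What remains is algebra in the selection probabilities,
  since each cell contribution is affine in every single probability.\<close>

text \<open>A singleton family is closed under intersection, so independence extends to the
  generated sigma-algebras, and these contain the complements.\<close>

lemma (in prob_space) indep_events_compl:
  assumes "indep_events F I"
  shows "indep_events (\<lambda>i. space M - F i) I"
proof -
  have "indep_sets (\<lambda>i. sigma_sets (space M) {F i}) I"
    using assms by (intro indep_sets_sigma) (auto simp: indep_events_def_alt Int_stable_def)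
  then have "indep_sets (\<lambda>i. {space M - F i}) I"
    by (rule indep_sets_mono_sets) (auto intro: sigma_sets.intros)
  then show ?thesis
    by (simp add: indep_events_def_alt)
qed

lemma (in prob_space) prob_UN_indep_events:
  assumes "indep_events F I" "finite I"
  shows "prob (\<Union>i\<in>I. F i) = 1 - (\<Prod>i\<in>I. 1 - prob (F i))"
proof (cases "I = {}")
  \<comment> \<open>Nonemptiness matters twice: an empty intersection would be \<open>UNIV\<close>
    rather than \<open>space M\<close>, and \<open>indep_events\<close> gives the product formula
    only for nonempty finite index sets. For empty \<open>I\<close> both sides are 0.\<close>
  case False
  have F: "F i \<in> events" if "i \<in> I" for i
    using assms that by (auto simp: indep_events_def)
  have "1 - prob (\<Union>i\<in>I. F i) = prob (space M - (\<Union>i\<in>I. F i))"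
    using F assms(2) by (intro prob_compl [symmetric]) auto
  also have "space M - (\<Union>i\<in>I. F i) = (\<Inter>i\<in>I. space M - F i)"
    using False by auto
  also have "prob \<dots> = (\<Prod>i\<in>I. prob (space M - F i))"
    using indep_events_compl [OF assms(1)] assms(2) False by (auto simp: indep_events_def)
  also have "\<dots> = (\<Prod>i\<in>I. 1 - prob (F i))"
    using F by (intro prod.cong) (auto simp: prob_compl)
  finally show ?thesis by simp
qed simp

lemma hit_event_UN:
  "hit_event \<Omega> (\<lambda>\<omega>. \<Union>k\<in>I. S k \<omega>) c = (\<Union>k\<in>I. hit_event \<Omega> (S k) c)"
  by (auto simp: hit_event_def)

text \<open>Treats the pooled selection as one more random selection, hit exactly when some client
  hits. The expectation formula below then serves both terms of the gap.\<close>

lemma sel_prob_UN: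
  assumes "prob_space \<Omega>" "finite I"
    and "prob_space.indep_events \<Omega> (\<lambda>k. hit_event \<Omega> (S k) c) I"
  shows "sel_prob \<Omega> (\<lambda>\<omega>. \<Union>k\<in>I. S k \<omega>) c = 1 - (\<Prod>k\<in>I. 1 - sel_prob \<Omega> (S k) c)"
  using prob_space.prob_UN_indep_events [OF assms(1,3,2)] by (simp add: sel_prob_def hit_event_UN)

lemma expectation_coverage:
  assumes "prob_space \<Omega>" and hit: "\<And>m. m \<in> {1..M} \<Longrightarrow> hit_event \<Omega> S (C m) \<in> sets \<Omega>"
  shows "(\<integral>\<omega>. coverage M C (S \<omega>) \<partial>\<Omega>) = (\<Sum>m=1..M. sel_prob \<Omega> S (C m))"
proof -
  interpret prob_space \<Omega> by fact
  have "(\<integral>\<omega>. coverage M C (S \<omega>) \<partial>\<Omega>)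
      = (\<integral>\<omega>. (\<Sum>m=1..M. indicator (hit_event \<Omega> S (C m)) \<omega>) \<partial>\<Omega>)"
    \<comment> \<open>The integrands need to agree only on \<open>space \<Omega>\<close>, to which
      \<open>hit_event\<close> is cut down.\<close>
    by (intro Bochner_Integration.integral_cong)
      (auto simp: coverage_def hit_event_def indicator_def intro!: sum.cong)
  also have "\<dots> = (\<Sum>m=1..M. \<integral>\<omega>. indicator (hit_event \<Omega> S (C m)) \<omega> \<partial>\<Omega>)"
    using hit by (intro Bochner_Integration.integral_sum) (simp add: emeasure_eq_measure)
  also have "\<dots> = (\<Sum>m=1..M. sel_prob \<Omega> S (C m))"
    using hit by (intro sum.cong) (simp_all add: sel_prob_def)
  finally show ?thesis .
qed

text \<open>Both expectations are sums over cells. Swapping the order of summation in the first lets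
  them be subtracted cell by cell; independence enters only through the pooled term.\<close>

lemma redundancy_gap_eq_sum_cell_contribution:
  assumes \<Omega>: "prob_space \<Omega>"
    and hit: "\<And>k m. k \<in> {1..K} \<Longrightarrow> m \<in> {1..M} \<Longrightarrow> hit_event \<Omega> (S k) (C m) \<in> sets \<Omega>"
    and indep: "indep_across_clients \<Omega> M C K S"
  shows "redundancy_gap \<Omega> M C K S
    = (\<Sum>m=1..M. cell_contribution K (\<lambda>k. sel_prob \<Omega> (S k) (C m)))"
proof -
  have "(\<Sum>k=1..K. \<integral>\<omega>. coverage M C (S k \<omega>) \<partial>\<Omega>)
      = (\<Sum>k=1..K. \<Sum>m=1..M. sel_prob \<Omega> (S k) (C m))"
    using hit by (intro sum.cong expectation_coverage [OF \<Omega>]) auto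
  also have "\<dots> = (\<Sum>m=1..M. \<Sum>k=1..K. sel_prob \<Omega> (S k) (C m))"
    by (rule sum.swap)
  finally have single: "(\<Sum>k=1..K. \<integral>\<omega>. coverage M C (S k \<omega>) \<partial>\<Omega>) = \<dots>" .
  have "(\<integral>\<omega>. coverage M C (\<Union>k\<in>{1..K}. S k \<omega>) \<partial>\<Omega>)
      = (\<Sum>m=1..M. sel_prob \<Omega> (\<lambda>\<omega>. \<Union>k\<in>{1..K}. S k \<omega>) (C m))"
    using hit by (intro expectation_coverage [OF \<Omega>]) (auto simp: hit_event_UN)
  also have "\<dots> = (\<Sum>m=1..M. 1 - (\<Prod>k=1..K. 1 - sel_prob \<Omega> (S k) (C m)))"
    using indep by (intro sum.cong sel_prob_UN [OF \<Omega>]) (auto simp: indep_across_clients_def)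
  finally show ?thesis
    unfolding redundancy_gap_def cell_contribution_def single by (simp only: sum_subtractf)
qed

text \<open>With a single nonzero entry \<open>a j\<close>, the sum is \<open>a j\<close> and the
  product is \<open>1 - a j\<close>, which cancel; with none, the sum is 0 and the product is
  1.\<close>

lemma cell_contribution_eq_0:
  assumes "\<And>i j. i \<in> {1..K} \<Longrightarrow> j \<in> {1..K} \<Longrightarrow> a i \<noteq> 0 \<Longrightarrow> a j \<noteq> 0 \<Longrightarrow> i = j"
  shows "cell_contribution K a = 0"
proof (cases "\<exists>j\<in>{1..K}. a j \<noteq> 0")
  case True
  then obtain j where j: "j \<in> {1..K}" "a j \<noteq> 0" by blast
  then have "a k = 0" if "k \<in> {1..K} - {j}" for k
    using assms that by blast
  then show ?thesis
    using j by (simp add: cell_contribution_def sum.remove [of _ j] prod.remove [of _ j])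
qed (simp add: cell_contribution_def)

text \<open>Write c for the old cover probability and p for the new entry. The sum grows by p and
  the cover probability by p (1 - c), which leaves p c.\<close>

lemma cell_contribution_Suc:
  "cell_contribution (Suc K) a - cell_contribution K a = a (Suc K) * joint_cover_prob K a"
  by (simp add: cell_contribution_def joint_cover_prob_def algebra_simps)

text \<open>Splitting index \<open>j\<close> off the sum and the product leaves an affine function
  of \<open>t\<close>, so the slope is the same at every \<open>x\<close>, including the endpoints
  of the unit interval.\<close>

lemma DERIV_cell_contribution:
  assumes "j \<in> {1..K}"
  shows "((\<lambda>t. cell_contribution K (a(j := t)))
    has_real_derivative (1 - (\<Prod>k\<in>{1..K} - {j}. 1 - a k))) (at x)"
proof -
  have "cell_contribution K (a(j := t)) = t + (\<Sum>k\<in>{1..K} - {j}. a k)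
      - (1 - (1 - t) * (\<Prod>k\<in>{1..K} - {j}. 1 - a k))" for t
    using assms by (simp add: cell_contribution_def sum.remove [of _ j] prod.remove [of _ j])
  then show ?thesis
    by (auto intro!: derivative_eq_intros)
qed

text \<open>All other factors lie in [0,1], so the product is at most the single factor
  \<open>1 - a j\<close>.\<close>

lemma prod_one_minus_less_one:
  fixes a :: "'i \<Rightarrow> real"
  assumes "finite I" "\<And>k. k \<in> I \<Longrightarrow> a k \<in> {0..1}" "j \<in> I" "0 < a j"
  shows "(\<Prod>k\<in>I. 1 - a k) < 1"
proof -
  have "(\<Prod>k\<in>I. 1 - a k) = (1 - a j) * (\<Prod>k\<in>I - {j}. 1 - a k)"
    using assms by (simp add: prod.remove)
  also have "\<dots> \<le> (1 - a j) * 1"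
    using assms by (intro mult_left_mono prod_le_1) auto
  finally show ?thesis using \<open>0 < a j\<close> by simp
qed

lemma client_hit_event_sets:
  "client \<Omega> X Y M C P b S \<Longrightarrow> m \<in> {1..M} \<Longrightarrow> hit_event \<Omega> S (C m) \<in> sets \<Omega>"
  by (simp add: client_def)

text \<open>Nonzero probability yields an outcome whose selection meets the cell; feasibility in the
  argmax puts the common point in the feature support.\<close>

lemma client_sel_prob_accessible:
  assumes "client \<Omega> X Y M C P b S" "m \<in> {1..M}" "sel_prob \<Omega> S (C m) \<noteq> 0"
  shows "m \<in> accessible_cells X M C P"
proof -
  have "hit_event \<Omega> S (C m) \<noteq> {}"
    using assms(3) by (auto simp: sel_prob_def)
  then show ?thesis
    using assms(1,2)
    by (fastforce simp: hit_event_def client_def is_arg_max_def accessible_cells_def)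
qed

theorem proposition1:
  fixes \<Omega> :: "'w measure"
    and X :: "(real ^ 'd) set" and Y :: "'y measure"
    and M K :: nat
    and C :: "nat \<Rightarrow> (real ^ 'd) set"
    and P :: "nat \<Rightarrow> ((real ^ 'd) \<times> 'y) measure"
    and b :: "nat \<Rightarrow> nat"
    and S :: "nat \<Rightarrow> 'w \<Rightarrow> (real ^ 'd) set"
  assumes prob: "prob_space \<Omega>"
    and cells_disjoint: "disjoint_family_on C {1..M}"
    and cells_cover: "(\<Union>m\<in>{1..M}. C m) = X"
    and K: "1 \<le> K"
    and clients: "\<forall>k\<in>{1..K}. client \<Omega> X Y M C (P k) (b k) (S k)"
    and indep: "indep_across_clients \<Omega> M C K S"
  shows
    "(disjoint_family_on (\<lambda>k. accessible_cells X M C (P k)) {1..K}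
        \<longrightarrow> redundancy_gap \<Omega> M C K S = 0)
     \<and>
     (redundancy_gap \<Omega> M C K S
        = (\<Sum>m=1..M. cell_contribution K (\<lambda>k. sel_prob \<Omega> (S k) (C m))) \<and>
      (\<forall>a. (\<forall>k\<in>{1..K}. a k \<in> {0..1}) \<longrightarrow>
        (\<forall>j\<in>{1..K}.
           ((\<lambda>t. cell_contribution K (a(j := t)))
              has_real_derivative (1 - (\<Prod>k\<in>{1..K} - {j}. 1 - a k))) (at (a j)) \<and>
           0 \<le> 1 - (\<Prod>k\<in>{1..K} - {j}. 1 - a k) \<and>
           ((\<exists>k\<in>{1..K} - {j}. 0 < a k) \<longrightarrow> 0 < 1 - (\<Prod>k\<in>{1..K} - {j}. 1 - a k)))))
     \<and>
     ((\<forall>m\<in>{1..M}.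
         measure \<Omega> {\<omega> \<in> space \<Omega>. \<exists>k\<in>{1..K}. S k \<omega> \<inter> C m \<noteq> {}}
           = joint_cover_prob K (\<lambda>k. sel_prob \<Omega> (S k) (C m))) \<and>
      (client \<Omega> X Y M C (P (K + 1)) (b (K + 1)) (S (K + 1)) \<and>
       indep_across_clients \<Omega> M C (K + 1) S \<longrightarrow>
         redundancy_gap \<Omega> M C (K + 1) S - redundancy_gap \<Omega> M C K S
           = (\<Sum>m=1..M. sel_prob \<Omega> (S (K + 1)) (C m)
                * joint_cover_prob K (\<lambda>k. sel_prob \<Omega> (S k) (C m)))))"
proof -
  have hit: "hit_event \<Omega> (S k) (C m) \<in> sets \<Omega>" if "k \<in> {1..K}" "m \<in> {1..M}" for k m
    using clients that client_hit_event_sets by blast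
  have gap: "redundancy_gap \<Omega> M C K S
      = (\<Sum>m=1..M. cell_contribution K (\<lambda>k. sel_prob \<Omega> (S k) (C m)))"
    using hit by (rule redundancy_gap_eq_sum_cell_contribution [OF prob _ indep])
  have disjoint: "redundancy_gap \<Omega> M C K S = 0"
    if disj: "disjoint_family_on (\<lambda>k. accessible_cells X M C (P k)) {1..K}"
  proof -
    \<comment> \<open>Two distinct clients hitting the same cell with nonzero probability would
      share an accessible cell, so each cell contribution has at most one nonzero entry.\<close>
    have unique: "i = j"
      if "m \<in> {1..M}" "i \<in> {1..K}" "j \<in> {1..K}"
        "sel_prob \<Omega> (S i) (C m) \<noteq> 0" "sel_prob \<Omega> (S j) (C m) \<noteq> 0" for i j m
    proof -
      have "m \<in> accessible_cells X M C (P i) \<inter> accessible_cells X M C (P j)"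
        using that clients client_sel_prob_accessible by blast
      then show ?thesis
        using disjoint_family_onD [OF disj that(2,3)] by blast
    qed
    show ?thesis
      unfolding gap by (intro sum.neutral ballI cell_contribution_eq_0; rule unique)
  qed
  have nonneg: "0 \<le> 1 - (\<Prod>k\<in>{1..K} - {j}. 1 - a k)"
    if "\<forall>k\<in>{1..K}. a k \<in> {0..1}" for a :: "nat \<Rightarrow> real" and j
    using that by (auto intro!: prod_le_1)
  have pos: "0 < 1 - (\<Prod>k\<in>{1..K} - {j}. 1 - a k)"
    if "\<forall>k\<in>{1..K}. a k \<in> {0..1}" "\<exists>k\<in>{1..K} - {j}. 0 < a k" for a :: "nat \<Rightarrow> real" and j
    using that prod_one_minus_less_one [of "{1..K} - {j}" a] by fastforce
  have cover: "measure \<Omega> {\<omega> \<in> space \<Omega>. \<exists>k\<in>{1..K}. S k \<omega> \<inter> C m \<noteq> {}}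
      = joint_cover_prob K (\<lambda>k. sel_prob \<Omega> (S k) (C m))" if "m \<in> {1..M}" for m
  proof -
    \<comment> \<open>Some client selects from the cell exactly when the pooled selection meets
      it.\<close>
    have "{\<omega> \<in> space \<Omega>. \<exists>k\<in>{1..K}. S k \<omega> \<inter> C m \<noteq> {}}
        = hit_event \<Omega> (\<lambda>\<omega>. \<Union>k\<in>{1..K}. S k \<omega>) (C m)"
      by (auto simp: hit_event_def)
    then show ?thesis
      using sel_prob_UN [OF prob, of "{1..K}" S "C m"] indep that
      by (simp add: sel_prob_def indep_across_clients_def joint_cover_prob_def)
  qed
  have increment: "redundancy_gap \<Omega> M C (K + 1) S - redundancy_gap \<Omega> M C K S
      = (\<Sum>m=1..M. sel_prob \<Omega> (S (K + 1)) (C m)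
          * joint_cover_prob K (\<lambda>k. sel_prob \<Omega> (S k) (C m)))"
    if new: "client \<Omega> X Y M C (P (K + 1)) (b (K + 1)) (S (K + 1))"
      and indep': "indep_across_clients \<Omega> M C (K + 1) S"
  proof -
    have "hit_event \<Omega> (S k) (C m) \<in> sets \<Omega>" if "k \<in> {1..K + 1}" "m \<in> {1..M}" for k m
      using that hit client_hit_event_sets [OF new]
      by (cases "k = K + 1") auto
    \<comment> \<open>The cell decomposition now holds for \<open>K\<close> and for
      \<open>K + 1\<close> clients, so the increment is computed cell by cell.\<close>
    then show ?thesis
      using redundancy_gap_eq_sum_cell_contribution [OF prob _ indep']
      by (simp add: gap cell_contribution_Suc flip: sum_subtractf)
  qed
  show ?thesis
    by (intro conjI impI allI ballI; (elim conjE)?;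
        rule disjoint gap nonneg pos cover increment DERIV_cell_contribution; assumption)
qed

end
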